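(* Let $n\geq 1$ and let $\{A(x): x\in\mathbb{F}_2^n\}$ be a system of subsets $A(x)\subseteq\mathbb{F}_2^n$ satisfying property $( * )$. If every non-empty $A(x)$ is a linear subspace of $\mathbb{F}_2^n$, then $$\sum_{x\in \mathbb{F}_2^n} |A(x)|\leq 3^n.$$
   Context: For $A\subseteq\mathbb{F}_2^n$ let $A\hat{+}A=\{a+a': a,a'\in A,\ a\neq a'\}$ be the restricted sumset. A system of subsets $A(x)\subseteq \mathbb{F}_2^n$ indexed by $x\in\mathbb{F}_2^n$ satisfies property $( * )$ if for all $x,y\in\mathbb{F}_2^n$: $y\in x+(A(x)\hat{+}A(x))$ implies $A(y)=\emptyset$. (If $A(x)=\emptyset$, then $x+(A(x)\hat{+}A(x))$ is defined to be $\emptyset$.) *)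

theory Defs
  imports "HOL-Analysis.Analysis" "HOL-Library.Z2"
begin

(* With this instance, "(bit, 'n) vec" is a finite type for every finite index type 'n,
   so cardinalities of its subsets and sums over all its elements are genuine. *)
instance bit :: finite
proof
  have "(UNIV :: bit set) \<subseteq> {0, 1}"
    using bit.exhaust by auto
  then show "finite (UNIV :: bit set)"
    by (rule finite_subset) simp
qed

definition restricted_sumset :: "(bit ^ 'n) set \<Rightarrow> (bit ^ 'n) set" where
  "restricted_sumset A = {a + a' | a a'. a \<in> A \<and> a' \<in> A \<and> a \<noteq> a'}"

(* The translate of the restricted sumset is empty whenever A x is, as the convention requires. *)
definition property_star :: "(bit ^ 'n \<Rightarrow> (bit ^ 'n) set) \<Rightarrow> bool" where
  "property_star A \<longleftrightarrow>
     (\<forall>x y. y \<in> (\<lambda>z. x + z) ` restricted_sumset (A x) \<longrightarrow> A y = {})"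

end

(* Over the field with two elements the indicator function of x + A x is a polynomial of degree at
   most n - dim (A x), and the star property says that at the points carrying a non-empty set these
   indicators evaluate to the identity matrix; hence they are linearly independent.
   So at most as many points x satisfy dim (A x) >= d as there are monomials of degree at
   most n - d.  Summation by parts bounds the sum of 2^dim (A x) by the sum of 2^(n - |T|) over all
   monomials T, which is 3^n.  The degree bound is read off the Moebius coefficients: the coefficient
   at T is the parity of the number of points of x + A x supported in T, and if
   |T| > n - dim (A x) these points are permuted freely by a nontrivial subspace. *)
theory Submission
  imports Defs
begin

section \<open>Sums over subsets of a finite set\<close>

lemma bit_add_self: "(a :: bit) + a = 0"
  by (cases a) simp_all

lemma sum_Pow_insert:
  assumes "finite B" "b \<notin> B"
  shows "sum f (Pow (insert b B)) = sum f (Pow B) + (\<Sum>T\<in>Pow B. f (insert b T))"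
proof -
  have "inj_on (insert b) (Pow B)"
    using assms(2) by (intro inj_onI) (auto dest: insert_ident[THEN iffD1, rotated 2])
  moreover have "Pow B \<inter> insert b ` Pow B = {}"
    using assms(2) by auto
  ultimately show ?thesis
    using assms(1) by (simp add: Pow_insert sum.union_disjoint sum.reindex)
qed

text \<open>The Moebius function of the subset lattice is 1 modulo 2, so taking subset sums is its
  own inverse: \<open>h C\<close> is counted once for each \<open>T\<close> between \<open>C\<close>
  and \<open>B\<close>, an even number of times unless \<open>C = B\<close>.\<close>

lemma moebius_inversion_bit:
  fixes h :: "'a set \<Rightarrow> bit"
  assumes "finite B"
  shows "(\<Sum>T\<in>Pow B. \<Sum>C\<in>Pow T. h C) = h B"
  using assms
proof (induction B arbitrary: h)
  case (insert b B)
  have "(\<Sum>T\<in>Pow (insert b B). sum h (Pow T))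
      = (\<Sum>T\<in>Pow B. sum h (Pow T) + sum h (Pow (insert b T)))"
    by (simp only: sum_Pow_insert[OF insert.hyps] sum.distrib)
  \<comment> \<open>Subsets of \<open>T\<close> occur in both sums and cancel in characteristic 2;
    what survives is an instance for \<open>h\<close> composed with \<open>insert b\<close>.\<close>
  also have "\<dots> = (\<Sum>T\<in>Pow B. \<Sum>C\<in>Pow T. h (insert b C))"
  proof (rule sum.cong[OF refl])
    fix T assume T: "T \<in> Pow B"
    then have "finite T" "b \<notin> T"
      using insert.hyps by (auto intro: finite_subset)
    then show "sum h (Pow T) + sum h (Pow (insert b T)) = (\<Sum>C\<in>Pow T. h (insert b C))"
      by (subst sum_Pow_insert)
        (simp_all only: add.assoc[symmetric] bit_add_self add_0_left not_False_eq_True)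
  qed
  also have "\<dots> = h (insert b B)"
    by (rule insert.IH)
  finally show ?case .
qed (simp only: Pow_empty sum.insert sum.empty finite.emptyI empty_iff not_False_eq_True add_0_right)

text \<open>Each \<open>T\<close> is weighted by the number of subsets of its complement in
  \<open>B\<close>, so every element of \<open>B\<close> has three options: in \<open>T\<close>, in
  the chosen subset, or in neither.\<close>

lemma sum_two_power_card_diff:
  assumes "finite B"
  shows "(\<Sum>T\<in>Pow B. 2 ^ (card B - card T)) = (3 :: nat) ^ card B"
  using assms
proof (induction B)
  case (insert b B)
  have "(\<Sum>T\<in>Pow (insert b B). 2 ^ (card (insert b B) - card T) :: nat)
      = (\<Sum>T\<in>Pow B. 2 * 2 ^ (card B - card T)) + (\<Sum>T\<in>Pow B. 2 ^ (card B - card T))"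
    unfolding sum_Pow_insert[OF insert.hyps]
  proof (intro arg_cong2[where f = "(+)"] sum.cong refl)
    fix T assume T: "T \<in> Pow B"
    then have "finite T" "b \<notin> T" "card T \<le> card B"
      using insert.hyps by (auto intro: finite_subset card_mono)
    then show "2 ^ (card (insert b B) - card T) = (2 * 2 ^ (card B - card T) :: nat)"
      and "2 ^ (card (insert b B) - card (insert b T)) = (2 ^ (card B - card T) :: nat)"
      using insert.hyps by (simp_all add: Suc_diff_le)
  qed
  then show ?case
    using insert by (simp flip: sum_distrib_left)
qed simp

section \<open>Summation by parts for powers of two\<close>

lemma two_power_eq_sum: "(2 :: nat) ^ k = 1 + (\<Sum>j<k. 2 ^ j)"
  by (induction k) auto

text \<open>Each power of two is expanded into the smaller ones; exchanging the sums collects the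
  weight \<open>2 ^ j\<close> once for every element above level \<open>j\<close>. The bound
  \<open>n\<close> gives all inner sums the same range.\<close>

lemma sum_two_power_layers:
  fixes f :: "'a \<Rightarrow> nat"
  assumes "finite X" "\<And>x. x \<in> X \<Longrightarrow> f x \<le> n"
  shows "(\<Sum>x\<in>X. 2 ^ f x) = card X + (\<Sum>j<n. 2 ^ j * card {x \<in> X. j < f x})"
proof -
  have "(\<Sum>x\<in>X. 2 ^ f x) = card X + (\<Sum>x\<in>X. \<Sum>j<f x. 2 ^ j)"
    by (subst two_power_eq_sum) (simp only: sum.distrib card_eq_sum)
  also have "(\<Sum>x\<in>X. \<Sum>j<f x. 2 ^ j) = (\<Sum>x\<in>X. \<Sum>j<n. if j < f x then 2 ^ j else (0 :: nat))"
  proof (rule sum.cong[OF refl])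
    fix x assume "x \<in> X"
    then have "{j \<in> {..<n}. j < f x} = {..<f x}"
      using assms(2)[of x] by auto
    then show "(\<Sum>j<f x. 2 ^ j) = (\<Sum>j<n. if j < f x then 2 ^ j else (0 :: nat))"
      by (simp flip: sum.inter_filter)
  qed
  also have "\<dots> = (\<Sum>j<n. 2 ^ j * card {x \<in> X. j < f x})"
    using assms(1) by (subst sum.swap) (simp add: mult.commute flip: sum.inter_filter)
  finally show ?thesis .
qed

text \<open>Both sums are the same nonnegative combination of layer sizes. Threshold 0 compares the
  cardinalities, threshold \<open>Suc j\<close> the layers of weight \<open>2 ^ j\<close>.\<close>

lemma sum_two_power_mono:
  fixes f :: "'a \<Rightarrow> nat" and g :: "'b \<Rightarrow> nat"
  assumes "finite X" "finite Y"
    and le: "\<And>d. card {x \<in> X. d \<le> f x} \<le> card {y \<in> Y. d \<le> g y}"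
  shows "(\<Sum>x\<in>X. 2 ^ f x) \<le> (\<Sum>y\<in>Y. 2 ^ g y :: nat)"
proof -
  \<comment> \<open>A common bound for both expansions; if \<open>X\<close> and \<open>Y\<close> are
    both empty its value is unspecified but harmless.\<close>
  define n where "n = Max (f ` X \<union> g ` Y)"
  have f: "f x \<le> n" if "x \<in> X" for x
    using that assms(1,2) by (auto simp: n_def intro: Max_ge)
  have g: "g y \<le> n" if "y \<in> Y" for y
    using that assms(1,2) by (auto simp: n_def intro: Max_ge)
  have "card X \<le> card Y"
    using le[of 0] by simp
  moreover have "card {x \<in> X. j < f x} \<le> card {y \<in> Y. j < g y}" for j
    using le[of "Suc j"] by (simp add: Suc_le_eq)
  ultimately show ?thesis
    using sum_two_power_layers[OF assms(1) f] sum_two_power_layers[OF assms(2) g]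
    by (auto intro!: add_mono sum_mono mult_left_mono)
qed

section \<open>Subspaces over the field with two elements\<close>

text \<open>Since 0 and 1 are the only scalars, adjoining a generator outside a span adds exactly
  one disjoint translate and so doubles it. The exponent is the dimension.\<close>

lemma card_bit_subspace:
  fixes V :: "(bit ^ 'n) set"
  assumes "vec.subspace V"
  obtains k where "card V = 2 ^ k"
proof -
  have "\<exists>k. card (vec.span B) = 2 ^ k" if "finite B" for B :: "(bit ^ 'n) set"
    using that
  proof (induction B)
    case empty
    then show ?case by (auto intro: exI[of _ 0])
  next
    case (insert b B)
    show ?case
    proof (cases "b \<in> vec.span B")
      case True
      then show ?thesis using insert.IH by (simp add: vec.span_redundant)
    next
      case False
      have coset: "vec.span (insert b B) = vec.span B \<union> (+) b ` vec.span B"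
      proof (intro equalityI subsetI)
        fix v assume "v \<in> vec.span (insert b B)"
        then obtain c where "v - c *s b \<in> vec.span B"
          by (auto simp: vec.span_insert)
        then have "v \<in> vec.span B \<or> v - b \<in> vec.span B"
          by (cases c) auto
        then show "v \<in> vec.span B \<union> (+) b ` vec.span B"
          by (auto simp: image_iff intro!: bexI[of _ "v - b"])
      next
        fix v assume "v \<in> vec.span B \<union> (+) b ` vec.span B"
        then show "v \<in> vec.span (insert b B)"
          using vec.span_mono[of B "insert b B"]
          by (auto intro!: vec.span_add vec.span_base[of b])
      qed
      have "vec.span B \<inter> (+) b ` vec.span B = {}"
      proof -
        have False if "v \<in> vec.span B" "b + v \<in> vec.span B" for v
          using vec.span_diff[OF that(2,1)] False by simp
        then show ?thesis by auto
      qed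
      then have "card (vec.span (insert b B)) = 2 * card (vec.span B)"
        unfolding coset by (simp add: card_Un_disjoint card_image)
      then show ?thesis
        using insert.IH by (metis power_Suc)
    qed
  qed
  \<comment> \<open>The space is finite, so \<open>V\<close> serves as its own finite generating
    set.\<close>
  from this[of V] obtain k where "card (vec.span V) = 2 ^ k" by auto
  moreover have "vec.span V = V"
    using assms by (simp only: vec.span_eq_iff)
  ultimately show thesis
    using that by metis
qed

text \<open>Identifies points with their supports, so that sums over the points supported in
  \<open>T\<close> become sums over \<open>Pow T\<close>.\<close>

definition char_vec :: "'n set \<Rightarrow> bit ^ 'n" where
  "char_vec C = (\<chi> i. of_bool (i \<in> C))"

lemma char_vec_nth [simp]: "char_vec C $ i = of_bool (i \<in> C)"
  by (simp add: char_vec_def)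

lemma inj_char_vec: "inj char_vec"
  by (intro injI) (auto simp: vec_eq_iff of_bool_eq_iff)

lemma char_vec_support [simp]: "char_vec {i. y $ i = 1} = y"
proof -
  have "of_bool (a = 1) = a" for a :: bit
    by (cases a) auto
  then show ?thesis by (simp add: vec_eq_iff)
qed

lemma char_vec_Pow: "char_vec ` Pow T = {z. \<forall>i. i \<notin> T \<longrightarrow> z $ i = 0}"
proof (intro equalityI subsetI)
  fix z assume "z \<in> {z. \<forall>i. i \<notin> T \<longrightarrow> (z :: bit ^ 'a) $ i = 0}"
  then show "z \<in> char_vec ` Pow T"
    by (intro image_eqI[of _ _ "{i. z $ i = 1}"]) auto
qed auto

lemma subspace_char_vec_Pow: "vec.subspace (char_vec ` Pow T)"
  by (auto simp: char_vec_Pow vec.subspace_def)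

lemma card_UNIV_bit [simp]: "CARD(bit) = 2"
proof -
  have "(UNIV :: bit set) = {0, 1}"
    using bit.exhaust by auto
  then have "CARD(bit) = card {0, 1 :: bit}"
    by (rule arg_cong)
  then show ?thesis by simp
qed

text \<open>Pigeonhole: addition on \<open>V \<times> W\<close> cannot be injective, and a collision
  yields a nonzero difference lying in both subspaces.\<close>

lemma subspaces_meet_nontrivially:
  fixes V W :: "(bit ^ 'n) set"
  assumes "vec.subspace V" "vec.subspace W" "2 ^ CARD('n) < card V * card W"
  obtains u where "u \<in> V" "u \<in> W" "u \<noteq> 0"
proof -
  have "card ((\<lambda>(v, w). v + w) ` (V \<times> W)) \<le> card (UNIV :: (bit ^ 'n) set)"
    by (rule card_mono) auto
  then have "\<not> inj_on (\<lambda>(v, w). v + w) (V \<times> W)"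
    using assms(3) by (intro notI) (simp add: card_image card_cartesian_product)
  then obtain v w v' w' where vw: "v \<in> V" "w \<in> W" "v' \<in> V" "w' \<in> W"
      "v + w = v' + w'" "(v, w) \<noteq> (v', w')"
    unfolding inj_on_def by auto
  from vw(5) have "v - v' = w' - w"
    by (simp add: algebra_simps)
  moreover have "v \<noteq> v'"
    using vw(5,6) by auto
  ultimately show thesis
    using vw(1-4) that[of "v - v'"] assms(1,2)
    by (metis vec.subspace_diff right_minus_eq)
qed

text \<open>The part of the coset \<open>x + V\<close> inside \<open>W\<close> is empty or a
  translate of \<open>V \<inter> W\<close>, which contains a nonzero vector, so its size is a
  positive power of two.\<close>

lemma even_card_coset_Int:
  fixes V W :: "(bit ^ 'n) set"
  assumes "vec.subspace V" "vec.subspace W" "2 ^ CARD('n) < card V * card W"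
  shows "even (card {z \<in> W. z - x \<in> V})"
proof (cases "{z \<in> W. z - x \<in> V} = {}")
  case False
  then obtain z where z: "z \<in> W" "z - x \<in> V" by auto
  have VW: "vec.subspace (V \<inter> W)"
    using assms by (simp add: vec.subspace_inter)
  then obtain k where k: "card (V \<inter> W) = 2 ^ k"
    by (rule card_bit_subspace)
  obtain u where "u \<in> V" "u \<in> W" "u \<noteq> 0"
    by (rule subspaces_meet_nontrivially[OF assms])
  then have "card {0, u} \<le> card (V \<inter> W)"
    using vec.subspace_0[OF VW] by (intro card_mono) auto
  then have "k \<noteq> 0"
    using k \<open>u \<noteq> 0\<close> by (intro notI) simp
  have "{z \<in> W. z - x \<in> V} = (+) z ` (V \<inter> W)"
  proof (intro equalityI subsetI)
    fix y assume "y \<in> {z \<in> W. z - x \<in> V}"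
    then have "y - z \<in> W" "(y - x) - (z - x) \<in> V"
      using z assms by (blast intro: vec.subspace_diff)+
    then show "y \<in> (+) z ` (V \<inter> W)"
      by (auto simp: image_iff intro!: bexI[of _ "y - z"])
  next
    fix y assume "y \<in> (+) z ` (V \<inter> W)"
    then obtain v where "y = z + v" "v \<in> V" "v \<in> W" by auto
    then show "y \<in> {z \<in> W. z - x \<in> V}"
      using z assms vec.subspace_add[OF assms(1) z(2), of v]
      by (auto intro: vec.subspace_add simp: algebra_simps)
  qed
  then show ?thesis
    using k \<open>k \<noteq> 0\<close> by (simp add: card_image)
next
  case True
  then show ?thesis by (simp only: card.empty even_zero)
qed

lemma of_nat_even_bit: "even m \<Longrightarrow> (of_nat m :: bit) = 0"
  by (auto elim!: evenE)

section \<open>Linear independence and counting monomials\<close>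

text \<open>The kernel of \<open>\<phi> x\<close> contains the span of all the other vectors but not
  \<open>c x\<close>, so the vectors are independent; they live in the coordinate subspace of
  \<open>K\<close>.\<close>

lemma card_le_of_separating_functionals:
  fixes c :: "'a \<Rightarrow> 'f :: field ^ 'm" and \<phi> :: "'a \<Rightarrow> 'f ^ 'm \<Rightarrow> 'f"
  assumes supp: "\<And>x T. x \<in> X \<Longrightarrow> T \<notin> K \<Longrightarrow> c x $ T = 0"
    and ker: "\<And>x. x \<in> X \<Longrightarrow> vec.subspace {v. \<phi> x v = 0}"
    and diag: "\<And>x. x \<in> X \<Longrightarrow> \<phi> x (c x) \<noteq> 0"
    and off_diag: "\<And>x y. x \<in> X \<Longrightarrow> y \<in> X \<Longrightarrow> x \<noteq> y \<Longrightarrow> \<phi> x (c y) = 0"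
  shows "card X \<le> card K"
proof -
  have "inj_on c X"
    using diag off_diag by (metis inj_onI)
  have "vec.independent (c ` X)"
    unfolding vec.dependent_def
  proof
    assume "\<exists>a\<in>c ` X. a \<in> vec.span (c ` X - {a})"
    then obtain x where x: "x \<in> X" "c x \<in> vec.span (c ` X - {c x})" by auto
    have "vec.span (c ` X - {c x}) \<subseteq> {v. \<phi> x v = 0}"
      using x(1) off_diag by (intro vec.span_minimal ker) auto
    then show False
      using x diag by auto
  qed
  moreover have "c ` X \<subseteq> vec.span ((\<lambda>T. axis T 1) ` K)"
  proof
    fix v assume "v \<in> c ` X"
    then have v: "v $ T = 0" if "T \<notin> K" for T
      using supp that by auto
    have "(\<Sum>T\<in>UNIV. v $ T *s axis T 1) \<in> vec.span ((\<lambda>T. axis T 1) ` K)"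
    proof (rule vec.span_sum)
      fix T
      show "v $ T *s axis T 1 \<in> vec.span ((\<lambda>T. axis T 1) ` K)"
        using v by (cases "T \<in> K") (auto intro: vec.span_scale vec.span_base vec.span_zero)
    qed
    then show "v \<in> vec.span ((\<lambda>T. axis T 1) ` K)"
      by (simp add: basis_expansion)
  qed
  ultimately have "card (c ` X) \<le> card ((\<lambda>T. axis T (1 :: 'f)) ` K)"
    by (intro conjunct2[OF vec.independent_span_bound]) simp_all
  also have "\<dots> \<le> card K"
    by (rule card_image_le) simp
  finally show ?thesis
    using \<open>inj_on c X\<close> by (simp add: card_image)
qed

text \<open>Used with \<open>K\<close> the set of monomials equal to 1 at a point, so that the sum
  is evaluation at that point.\<close>

lemma subspace_sum_coordinates_eq_0:
  "vec.subspace {v :: 'f :: field ^ 'm. (\<Sum>i\<in>K. v $ i) = 0}"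
  by (simp add: vec.subspace_def sum.distrib flip: sum_distrib_left)

text \<open>By \<open>sep\<close>, the coset \<open>x + V x\<close> meets \<open>X\<close> only in
  \<open>x\<close>, so evaluation at the points of \<open>X\<close> separates the indicators of
  these cosets. The sets \<open>T\<close> counted are the monomials of degree at most
  \<open>CARD('n) - d\<close>.\<close>

lemma card_le_card_low_degree_monomials:
  fixes V :: "bit ^ 'n \<Rightarrow> (bit ^ 'n) set"
  assumes sub: "\<And>x. x \<in> X \<Longrightarrow> vec.subspace (V x)"
    and large: "\<And>x. x \<in> X \<Longrightarrow> 2 ^ d \<le> card (V x)"
    and sep: "\<And>x y. x \<in> X \<Longrightarrow> y \<in> X \<Longrightarrow> y - x \<in> V x \<Longrightarrow> y = x"
  shows "card X \<le> card {T :: 'n set. d \<le> CARD('n) - card T}"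
proof (cases "d = 0")
  case True
  have "card X \<le> card (UNIV :: (bit ^ 'n) set)"
    by (rule card_mono) auto
  then show ?thesis
    using True by (simp add: card_UNIV_set)
next
  case False
  \<comment> \<open>Coefficients of the polynomial for the indicator of \<open>x + V x\<close>,
    obtained by Moebius transform.\<close>
  define c :: "bit ^ 'n \<Rightarrow> bit ^ ('n set)"
    where "c x = (\<chi> T. \<Sum>C\<in>Pow T. of_bool (char_vec C - x \<in> V x))" for x
  \<comment> \<open>Evaluation at \<open>y\<close>: the monomial of \<open>T\<close> is 1 there
    exactly when \<open>T\<close> lies in the support of \<open>y\<close>.\<close>
  define \<phi> :: "bit ^ 'n \<Rightarrow> bit ^ ('n set) \<Rightarrow> bit"
    where "\<phi> y v = (\<Sum>T\<in>Pow {i. y $ i = 1}. v $ T)" for y v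
  have \<phi>_c: "\<phi> y (c x) = of_bool (y - x \<in> V x)" for x y
    by (simp only: \<phi>_def c_def vec_lambda_beta moebius_inversion_bit finite char_vec_support)
  show ?thesis
  proof (rule card_le_of_separating_functionals[where c = c and \<phi> = \<phi>])
    fix x and T :: "'n set"
    assume x: "x \<in> X" and "T \<notin> {T. d \<le> CARD('n) - card T}"
    \<comment> \<open>For such a \<open>T\<close>, \<open>V x\<close> and the coordinate subspace of
      \<open>T\<close> are too large to meet only in 0, so the coefficient at \<open>T\<close> is
      the parity of an even number.\<close>
    then have "CARD('n) < d + card T" by auto
    then have "(2 :: nat) ^ CARD('n) < 2 ^ d * 2 ^ card T"
      by (simp flip: power_add)
    also have "\<dots> \<le> card (V x) * card (char_vec ` Pow T)"
      using large[OF x]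
      by (simp add: card_image inj_on_subset[OF inj_char_vec] card_Pow)
    finally have "even (card {z \<in> char_vec ` Pow T. z - x \<in> V x})"
      by (intro even_card_coset_Int sub x subspace_char_vec_Pow)
    then have "(\<Sum>z\<in>char_vec ` Pow T. of_bool (z - x \<in> V x)) = (0 :: bit)"
      by (simp add: of_bool_def of_nat_even_bit flip: sum.inter_filter)
    then show "c x $ T = 0"
      by (simp only: c_def vec_lambda_beta o_def
          sum.reindex[OF inj_on_subset[OF inj_char_vec subset_UNIV]])
  next
    fix x
    show "vec.subspace {v. \<phi> x v = 0}"
      unfolding \<phi>_def by (rule subspace_sum_coordinates_eq_0)
  next
    fix x assume "x \<in> X"
    then show "\<phi> x (c x) \<noteq> 0"
      using vec.subspace_0[OF sub] by (simp add: \<phi>_c)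
  next
    fix x y assume "x \<in> X" "y \<in> X" "x \<noteq> y"
    then show "\<phi> x (c y) = 0"
      using sep[of y x] by (auto simp: \<phi>_c)
  qed
qed

theorem theorem3p17:
  fixes A :: "bit ^ 'n \<Rightarrow> (bit ^ 'n) set"
  assumes "property_star A"
    and "\<And>x. A x \<noteq> {} \<Longrightarrow> vec.subspace (A x)"
  shows "(\<Sum>x\<in>UNIV. card (A x)) \<le> 3 ^ CARD('n)"
proof -
  define S where "S = {x. A x \<noteq> {}}"
  have sub: "vec.subspace (A x)" if "x \<in> S" for x
    using assms(2) that by (simp add: S_def)
  \<comment> \<open>As 0 lies in the subspace \<open>A x\<close>, each nonzero \<open>y - x\<close>
    in it is the restricted sum \<open>(y - x) + 0\<close>, so the star property would empty
    \<open>A y\<close>.\<close>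
  have sep: "y = x" if "x \<in> S" "y \<in> S" "y - x \<in> A x" for x y
  proof (rule ccontr)
    assume "y \<noteq> x"
    moreover have "0 \<in> A x"
      using sub[OF that(1)] by (rule vec.subspace_0)
    ultimately have "(y - x) + 0 \<in> restricted_sumset (A x)"
      unfolding restricted_sumset_def using that(3) by force
    then have "y \<in> (\<lambda>z. x + z) ` restricted_sumset (A x)"
      by (auto simp: image_iff intro!: bexI[of _ "y - x"])
    then have "A y = {}"
      using assms(1) unfolding property_star_def by blast
    then show False
      using that(2) by (simp add: S_def)
  qed
  have "\<exists>k. card (A x) = 2 ^ k" if "x \<in> S" for x
    by (rule card_bit_subspace[OF sub[OF that]]) blast
  then obtain d where d: "\<And>x. x \<in> S \<Longrightarrow> card (A x) = 2 ^ d x"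
    by metis
  have "(\<Sum>x\<in>UNIV. card (A x)) = (\<Sum>x\<in>S. 2 ^ d x)"
    using d by (intro sum.mono_neutral_cong_right) (auto simp: S_def)
  \<comment> \<open>The dimensions on \<open>S\<close> are compared with the codegrees of all
    monomials, threshold by threshold.\<close>
  also have "\<dots> \<le> (\<Sum>T\<in>UNIV. 2 ^ (CARD('n) - card (T :: 'n set)))"
  proof (rule sum_two_power_mono)
    fix k
    have "card {x \<in> S. k \<le> d x} \<le> card {T :: 'n set. k \<le> CARD('n) - card T}"
      by (rule card_le_card_low_degree_monomials[where V = A]) (auto simp: sub d sep)
    then show "card {x \<in> S. k \<le> d x} \<le> card {T \<in> UNIV :: 'n set set. k \<le> CARD('n) - card T}"
      by simp
  qed auto
  also have "\<dots> = 3 ^ CARD('n)"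
    using sum_two_power_card_diff[of "UNIV :: 'n set"] by simp
  finally show ?thesis .
qed

end
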